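(* The space of $\mathcal YSym$-coinvariants of $\mathcal MSym$, $\{m\in\mathcal MSym\mid\boldsymbol\rho(m)=m\otimes1\}$, has basis $\{M_b\mid b\in\mathcal B'\}$.
   Context: Permutations. $\mathfrak S_n$ is the set of permutations of $\{1,\dots,n\}$ written as words ($\mathfrak S_0=\{\emptyset\}$), with the weak order whose covers are $w\lessdot(k,k+1)w$ when the value $k$ occurs before $k+1$ in $w$ (and $(k,k+1)w$ swaps these two values). $\overline a$ denotes the standardization of a word $a$ with distinct letters. Trees. $\mathcal Y_n$ is the set of rooted planar binary trees with $n$ internal nodes; $|$ is the tree with no nodes; $\mathcal Y_\bullet=\bigsqcup_{n\ge0}\mathcal Y_n$ and $\mathcal Y_+=\bigsqcup_{n\ge1}\mathcal Y_n$; $t_\ell\vee t_r$ is the tree whose root node has left and right subtrees $t_\ell,t_r$. A tree in $\mathcal Y_n$ has leaves numbered $0,\dots,n$ and nodes numbered $1,\dots,n$ from left to right (node $i$ is the gap between leaves $i-1$ and $i$). Its node poset has the internal edges as Hasse diagram and the root as maximum. The Tamari order on $\mathcal Y_n$ has covers given by replacing a subtree $(x\vee y)\vee z$ by $x\vee(y\vee z)$. The map $\tau\colon\mathfrak S_n\to\mathcal Y_n$ is given by $\tau(\emptyset)=|$ and, if $w(j)=n$, $\tau(w)=\tau(\overline{w(1)\cdots w(j-1)})\vee\tau(\overline{w(j+1)\cdots w(n)})$. Its fibers are intervals in the weak order, and $\mathsf{max}(t)$ is the maximum of $\tau^{-1}(t)$ (the unique $132$-avoiding element). Bi-leveled trees.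 $\mathcal M_n$ is the set of pairs $(t;\mathsf T)$ with $t\in\mathcal Y_n$ and $\mathsf T\subseteq\{1,\dots,n\}$ an upper order ideal of the node poset of $t$ containing the leftmost node (node $1$) as a minimal element of $\mathsf T$; $\mathcal M_0=\{|\}$; $\mathcal M_\bullet=\bigsqcup_{n\ge0}\mathcal M_n$, $\mathcal M_+=\bigsqcup_{n\ge1}\mathcal M_n$. The order on $\mathcal M_n$: $(s;\mathsf S)\le(t;\mathsf T)$ iff $s\le t$ in the Tamari order and $\mathsf S\supseteq\mathsf T$. $\beta\colon\mathfrak S_n\to\mathcal M_n$ is $\beta(w)=(\tau(w);\{i\mid w(i)\ge w(1)\})$. For $c\in\mathcal M_+$ and $s\in\mathcal Y_\bullet$, $c\backslash s$ is the bi-leveled tree whose underlying tree is obtained by grafting the root of $s$ onto the rightmost leaf of the underlying tree of $c$, with order ideal that of $c$. $\mathcal B\subset\mathcal M_+$ is the set of indecomposable bi-leveled trees: those $b$ whose only decomposition $b=c\backslash s$ is $b=b\backslash|$. $\mathcal B'$ consists of $|$ together with those $b\in\mathcal B$ that are not of the form $\beta(\mathsf{max}(t))$ for any $t\in\mathcal Y_+$. Spaces. $\mathcal MSym$ and $\mathcal YSym$ are the graded $\mathbb Q$-vector spaces with bases $\{F_b\mid b\in\mathcal M_\bullet\}$ and $\{F_t\mid t\in\mathcal Y_\bullet\}$; $1=F_|$. $\mathcal YSym$ is the Loday–Ronco Hopf algebra, with coproduct $\Delta F_t=\sum_{t\to(t_0,t_1)}F_{t_0}\otimes F_{t_1}$.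 With $\mu$ the Möbius function of $\mathcal M_n$, $M_b=\sum_{b\le c}\mu(b,c)F_c$. Coaction. Splitting $t\in\mathcal Y_n$ along leaf $i$ means cutting along the path from leaf $i$ to the root, giving $t\to(t_0,t_1)$ with $t_0\in\mathcal Y_i$ containing nodes $1,\dots,i$ and $t_1$ containing nodes $i+1,\dots,n$; equivalently, $t_0=\tau(\overline{w(1)\cdots w(i)})$, $t_1=\tau(\overline{w(i+1)\cdots w(n)})$ for any $w\in\tau^{-1}(t)$. For $b=(t;\mathsf T)$ it induces $b\to(b_0,b_1)$ with $b_i=(t_i;\mathsf T|_{t_i})$; $b_0$ is bi-leveled and $\phi(b_1)=t_1$. The coaction is the linear map $\boldsymbol\rho\colon\mathcal MSym\to\mathcal MSym\otimes\mathcal YSym$, $\boldsymbol\rho(F_b)=\sum_{b\to(b_0,b_1)}F_{b_0}\otimes F_{\phi(b_1)}$, the sum over splittings along one leaf. *)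

theory Defs
  imports
    Complex_Main
    "HOL-Library.Tree"
    "HOL-Library.Poly_Mapping"
    "HOL-Combinatorics.Multiset_Permutations"
    "HOL-Combinatorics.Transposition"
begin

section \<open>Planar binary trees\<close>

text \<open>
  Nodes carry no labels. The number of internal nodes is \<^term>\<open>size t\<close>, and the leaf
  \<^term>\<open>Leaf\<close> is also the tree without nodes.
\<close>

type_synonym ptree = "unit tree"

abbreviation join :: "ptree \<Rightarrow> ptree \<Rightarrow> ptree" where
  "join l r \<equiv> Node l () r"

inductive tamari_cover :: "ptree \<Rightarrow> ptree \<Rightarrow> bool" where
  rotate: "tamari_cover (join (join x y) z) (join x (join y z))"
| in_left: "tamari_cover l l' \<Longrightarrow> tamari_cover (join l r) (join l' r)"
| in_right: "tamari_cover r r' \<Longrightarrow> tamari_cover (join l r) (join l r')"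

definition tamari_le :: "ptree \<Rightarrow> ptree \<Rightarrow> bool" where
  "tamari_le = tamari_cover\<^sup>*\<^sup>*"

text \<open>
  Nodes are numbered from 1 from left to right, so the root of \<^term>\<open>join l r\<close> has
  number \<^term>\<open>Suc (size l)\<close>, and node \<open>i\<close> of \<^term>\<open>r\<close> has number \<open>Suc (size l) + i\<close>.
  \<open>node_edges\<close> consists of the pairs (child, parent).
\<close>

abbreviation root_node :: "ptree \<Rightarrow> nat" where
  "root_node t \<equiv> Suc (size (left t))"

fun node_edges :: "ptree \<Rightarrow> (nat \<times> nat) set" where
  "node_edges Leaf = {}"
| "node_edges (Node l _ r) =
     (let k = Suc (size l) in
        node_edges l \<union> (\<lambda>(i, j). (k + i, k + j)) ` node_edges r
        \<union> (if l = Leaf then {} else {(root_node l, k)})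
        \<union> (if r = Leaf then {} else {(k + root_node r, k)}))"

definition node_le :: "ptree \<Rightarrow> nat \<Rightarrow> nat \<Rightarrow> bool" where
  "node_le t i j \<longleftrightarrow> (i, j) \<in> (node_edges t)\<^sup>*"

text \<open>\<open>split_tree t i\<close> cuts \<open>t\<close> along the path from leaf \<open>i\<close> (counted from 0) to the root.\<close>

fun split_tree :: "ptree \<Rightarrow> nat \<Rightarrow> ptree \<times> ptree" where
  "split_tree Leaf i = (Leaf, Leaf)"
| "split_tree (Node l _ r) i =
     (if i \<le> size l
      then (case split_tree l i of (l0, l1) \<Rightarrow> (l0, join l1 r))
      else (case split_tree r (i - Suc (size l)) of (r0, r1) \<Rightarrow> (join l r0, r1)))"

fun graft_right :: "ptree \<Rightarrow> ptree \<Rightarrow> ptree" where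
  "graft_right Leaf s = s"
| "graft_right (Node l _ r) s = join l (graft_right r s)"


section \<open>Permutations\<close>

text \<open>
  The symmetric group on \<open>{1..n}\<close> is \<^term>\<open>permutations_of_set {1..n::nat}\<close>, a set of words;
  the letter \<open>w(i)\<close> is \<open>w ! (i - 1)\<close>.
\<close>

definition standardize :: "nat list \<Rightarrow> nat list" where
  "standardize w = map (\<lambda>x. card {y \<in> set w. y \<le> x}) w"

lemma length_standardize [simp]: "length (standardize w) = length w"
  by (simp add: standardize_def)

text \<open>For \<open>w\<close> in the symmetric group on \<open>{1..n}\<close> the letter \<open>m\<close> below is \<open>n\<close>.\<close>

function tau :: "nat list \<Rightarrow> ptree" where
  "tau w = (if w = [] then Leaf else
     (let m = Max (set w) in
        join (tau (standardize (takeWhile (\<lambda>x. x \<noteq> m) w)))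
             (tau (standardize (tl (dropWhile (\<lambda>x. x \<noteq> m) w))))))"
  by auto
termination
proof (relation "measure length", goal_cases)
  case 1 then show ?case by simp
next
  case (2 w m)
  then have "m \<in> set w" by simp
  then have "length (takeWhile (\<lambda>x. x \<noteq> m) w) < length w"
    by (induction w) auto
  then show ?case by simp
next
  case (3 w m)
  have "length (dropWhile (\<lambda>x. x \<noteq> m) w) \<le> length w"
    by (rule length_dropWhile_le)
  with 3 show ?case by (cases w) auto
qed

declare tau.simps [simp del]

inductive weak_cover :: "nat list \<Rightarrow> nat list \<Rightarrow> bool" where
  "\<lbrakk>i < j; j < length w; w ! i = k; w ! j = Suc k\<rbrakk>
   \<Longrightarrow> weak_cover w (map (transpose k (Suc k)) w)"

definition weak_le :: "nat list \<Rightarrow> nat list \<Rightarrow> bool" where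
  "weak_le = weak_cover\<^sup>*\<^sup>*"

definition tau_fiber :: "ptree \<Rightarrow> nat list set" where
  "tau_fiber t = {w \<in> permutations_of_set {1..size t}. tau w = t}"

definition max_perm :: "ptree \<Rightarrow> nat list" where
  "max_perm t = (THE w. w \<in> tau_fiber t \<and> (\<forall>v \<in> tau_fiber t. weak_le v w))"


section \<open>Facts on trees and their node posets\<close>

lemma node_edges_bounds:
  "(i, j) \<in> node_edges t \<Longrightarrow> 1 \<le> i \<and> i \<le> size t \<and> 1 \<le> j \<and> j \<le> size t"
proof (induction t arbitrary: i j)
  case Leaf then show ?case by simp
next
  case (Node l x r)
  have l: "l \<noteq> Leaf \<Longrightarrow> Suc (size (left l)) \<le> size l" for l :: ptree by (cases l) auto
  show ?case using Node.prems l[of l] l[of r]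
    by (auto simp: Let_def split: if_splits dest: Node.IH)
qed

lemma node_edges_shift:
  "(i, j) \<in> (node_edges r)\<^sup>* \<Longrightarrow> (Suc (size l) + i, Suc (size l) + j) \<in> (node_edges (Node l x r))\<^sup>*"
proof (induction rule: rtrancl_induct)
  case base show ?case by simp
next
  case (step y z)
  have "(Suc (size l) + y, Suc (size l) + z) \<in> node_edges (Node l x r)"
    using step(2) unfolding node_edges.simps Let_def by force
  with step(3) show ?case by (rule rtrancl_into_rtrancl)
qed

lemma node_edges_left:
  "(i, j) \<in> (node_edges l)\<^sup>* \<Longrightarrow> (i, j) \<in> (node_edges (Node l x r))\<^sup>*"
  by (rule rtrancl_mono [THEN subsetD]) (auto simp: Let_def)

lemma node_le_root: "1 \<le> i \<Longrightarrow> i \<le> size t \<Longrightarrow> node_le t i (root_node t)"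
proof (induction t arbitrary: i)
  case Leaf then show ?case by simp
next
  case (Node l x r)
  consider "i \<le> size l" | "i = Suc (size l)" | "i > Suc (size l)" by linarith
  then show ?case
  proof cases
    case 1
    then have "l \<noteq> Leaf" using Node.prems by auto
    have "node_le l i (root_node l)" using Node.IH(1) Node.prems(1) 1 by blast
    then have "(i, root_node l) \<in> (node_edges (Node l x r))\<^sup>*"
      unfolding node_le_def by (rule node_edges_left)
    moreover have "(root_node l, Suc (size l)) \<in> node_edges (Node l x r)"
      using \<open>l \<noteq> Leaf\<close> by (simp add: Let_def)
    ultimately have "(i, Suc (size l)) \<in> (node_edges (Node l x r))\<^sup>*"
      by (rule rtrancl_into_rtrancl)
    then show ?thesis by (simp add: node_le_def)
  next
    case 2 then show ?thesis by (simp add: node_le_def)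
  next
    case 3
    then have "r \<noteq> Leaf" using Node.prems by auto
    define i' where "i' = i - Suc (size l)"
    have i: "i = Suc (size l) + i'" and "1 \<le> i'" "i' \<le> size r"
      using 3 Node.prems by (auto simp: i'_def)
    then have "node_le r i' (root_node r)" using Node.IH(2) by blast
    then have "(i, Suc (size l) + root_node r) \<in> (node_edges (Node l x r))\<^sup>*"
      unfolding node_le_def i by (rule node_edges_shift)
    moreover have "(Suc (size l) + root_node r, Suc (size l)) \<in> node_edges (Node l x r)"
      using \<open>r \<noteq> Leaf\<close> by (simp add: Let_def)
    ultimately have "(i, Suc (size l)) \<in> (node_edges (Node l x r))\<^sup>*"
      by (rule rtrancl_into_rtrancl)
    then show ?thesis by (simp add: node_le_def)
  qed
qed

lemma node_le_bounds:
  assumes "node_le t i j" "1 \<le> i" "i \<le> size t"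
  shows "1 \<le> j \<and> j \<le> size t"
  using assms(1) unfolding node_le_def
proof (induction rule: rtrancl_induct)
  case base show ?case using assms by simp
next
  case (step y z) then show ?case using node_edges_bounds by blast
qed

lemma node_le_join:
  assumes "1 \<le> i" "i \<le> size (Node l x r)"
  shows "node_le (Node l x r) i j \<longleftrightarrow>
    (i \<le> size l \<and> j \<le> size l \<and> node_le l i j) \<or> j = Suc (size l) \<or>
    (i > Suc (size l) \<and> j > Suc (size l) \<and> node_le r (i - Suc (size l)) (j - Suc (size l)))"
    (is "?L \<longleftrightarrow> ?R")
proof
  assume ?L
  then have "(i, j) \<in> (node_edges (Node l x r))\<^sup>*" by (simp add: node_le_def)
  then show ?R
  proof (induction rule: rtrancl_induct)
    case base
    show ?case using assms by (auto simp: node_le_def)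
  next
    case (step y z)
    have lw: "t \<noteq> Leaf \<Longrightarrow> Suc (size (left t)) \<le> size t" for t :: ptree by (cases t) auto
    from step(2) consider "z = Suc (size l)" | "(y, z) \<in> node_edges l"
      | y' z' where "(y', z') \<in> node_edges r" "y = Suc (size l) + y'" "z = Suc (size l) + z'"
      by (fastforce simp: Let_def split: if_splits)
    then show ?case
    proof cases
      case 1 then show ?thesis by simp
    next
      case 2
      from node_edges_bounds[OF this] have b: "y \<le> size l" "z \<le> size l" by auto
      with step(3) have "i \<le> size l" "node_le l i y" by auto
      then show ?thesis using 2 b by (auto simp: node_le_def intro: rtrancl_into_rtrancl)
    next
      case 3
      from node_edges_bounds[OF 3(1)] have b: "1 \<le> y'" "1 \<le> z'" by auto
      with step(3) 3 have "i > Suc (size l)" "node_le r (i - Suc (size l)) y'" by auto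
      then show ?thesis using 3 b by (auto simp: node_le_def intro: rtrancl_into_rtrancl)
    qed
  qed
next
  assume ?R
  then consider "node_le l i j" | "j = Suc (size l)"
    | "i > Suc (size l)" "j > Suc (size l)" "node_le r (i - Suc (size l)) (j - Suc (size l))"
    by blast
  then show ?L
  proof cases
    case 1 then show ?thesis unfolding node_le_def by (rule node_edges_left)
  next
    case 2 then show ?thesis using node_le_root[OF assms] by simp
  next
    case 3 then show ?thesis
      using node_edges_shift[of "i - Suc (size l)" "j - Suc (size l)" r l x]
      unfolding node_le_def by simp
  qed
qed

lemma size_split_tree:
  "i \<le> size t \<Longrightarrow> size (fst (split_tree t i)) = i \<and> size (snd (split_tree t i)) = size t - i"
proof (induction t arbitrary: i)
  case Leaf then show ?case by simp
next
  case (Node l x r)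
  show ?case
  proof (cases "i \<le> size l")
    case True
    obtain l0 l1 where l: "split_tree l i = (l0, l1)" by fastforce
    from Node.IH(1)[OF True] show ?thesis using True l by simp
  next
    case False
    obtain r0 r1 where r: "split_tree r (i - Suc (size l)) = (r0, r1)" by fastforce
    have "i - Suc (size l) \<le> size r" using Node.prems by simp
    from Node.IH(2)[OF this] show ?thesis using False r Node.prems by simp
  qed
qed

lemma node_le_split_tree:
  assumes "k \<le> size t" "1 \<le> i" "i \<le> k" "1 \<le> j" "j \<le> k"
  shows "node_le (fst (split_tree t k)) i j \<longleftrightarrow> node_le t i j"
  using assms
proof (induction t arbitrary: i j k)
  case Leaf then show ?case by simp
next
  case (Node l x r)
  show ?case
  proof (cases "k \<le> size l")
    case True
    obtain l0 l1 where l: "split_tree l k = (l0, l1)" by fastforce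
    have "fst (split_tree (Node l x r) k) = l0" using True l by simp
    moreover have "node_le l0 i j = node_le l i j"
      using Node.IH(1)[of k i j] True Node.prems l by simp
    moreover have "node_le (Node l x r) i j = node_le l i j"
      using True Node.prems by (subst node_le_join) auto
    ultimately show ?thesis by simp
  next
    case False
    obtain r0 r1 where r: "split_tree r (k - Suc (size l)) = (r0, r1)" by fastforce
    have k: "k - Suc (size l) \<le> size r" using Node.prems by auto
    have sz: "size r0 = k - Suc (size l)" using size_split_tree[OF k] r by simp
    have eq: "fst (split_tree (Node l x r) k) = join l r0" using False r by simp
    have IH: "node_le r0 (i - Suc (size l)) (j - Suc (size l))
        = node_le r (i - Suc (size l)) (j - Suc (size l))"
      if "i > Suc (size l)" "j > Suc (size l)"
      using Node.IH(2)[OF k, of "i - Suc (size l)" "j - Suc (size l)"] that r Node.prems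
      by simp
    show ?thesis unfolding eq using IH Node.prems False sz
      by (subst (1 2) node_le_join) auto
  qed
qed

lemma size_graft_right [simp]: "size (graft_right c s) = size c + size s"
  by (induction c) auto

lemma node_le_graft_right:
  assumes "1 \<le> i" "i \<le> size c"
  shows "node_le (graft_right c s) i j \<longleftrightarrow> node_le c i j"
  using assms
proof (induction c arbitrary: i j)
  case Leaf then show ?case by simp
next
  case (Node l x r)
  then show ?case using Node.IH(2)[of "i - Suc (size l)" "j - Suc (size l)"]
    by (auto simp: node_le_join)
qed

lemma standardize_mono:
  assumes "i < length w" "j < length w"
  shows "standardize w ! i \<le> standardize w ! j \<longleftrightarrow> w ! i \<le> w ! j"
proof
  assume L: "standardize w ! i \<le> standardize w ! j"
  show "w ! i \<le> w ! j"
  proof (rule ccontr)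
    assume "\<not> w ! i \<le> w ! j"
    then have "{y \<in> set w. y \<le> w ! j} \<subset> {y \<in> set w. y \<le> w ! i}"
      using assms by (auto intro!: psubsetI dest: nth_mem)
    then have "card {y \<in> set w. y \<le> w ! j} < card {y \<in> set w. y \<le> w ! i}"
      by (intro psubset_card_mono) auto
    with L show False using assms by (simp add: standardize_def)
  qed
next
  assume "w ! i \<le> w ! j"
  then show "standardize w ! i \<le> standardize w ! j"
    using assms by (auto simp: standardize_def intro!: card_mono)
qed

lemma size_tau_node_le:
  "size (tau w) = length w \<and>
   (\<forall>i j. 1 \<le> i \<longrightarrow> i \<le> length w \<longrightarrow> node_le (tau w) i j \<longrightarrow> w ! (i - 1) \<le> w ! (j - 1))"
proof (induction w rule: tau.induct)
  case (1 w)
  show ?case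
  proof (cases "w = []")
    case True then show ?thesis by (simp add: tau.simps)
  next
    case False
    define m where "m = Max (set w)"
    define u where "u = takeWhile (\<lambda>x. x \<noteq> m) w"
    define v where "v = tl (dropWhile (\<lambda>x. x \<noteq> m) w)"
    have "m \<in> set w" using False by (simp add: m_def)
    then have "dropWhile (\<lambda>x. x \<noteq> m) w = m # v"
      unfolding v_def by (induction w) auto
    then have w: "w = u @ m # v"
      unfolding u_def by (metis takeWhile_dropWhile_id)
    have t: "tau w = join (tau (standardize u)) (tau (standardize v))"
      using False by (subst tau.simps) (simp add: Let_def m_def u_def v_def)
    note IHu = "1.IH"(1)[OF False m_def, folded u_def]
    note IHv = "1.IH"(2)[OF False m_def, folded v_def]
    have su: "size (tau (standardize u)) = length u" using IHu by simp
    have sv: "size (tau (standardize v)) = length v" using IHv by simp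
    have sz: "size (tau w) = length w" using t su sv w by simp
    have "w ! (i - 1) \<le> w ! (j - 1)"
      if i: "1 \<le> i" "i \<le> length w" and le: "node_le (tau w) i j" for i j
    proof -
      have j: "1 \<le> j" "j \<le> length w" using node_le_bounds[OF le] i sz by auto
      have "i \<le> size (join (tau (standardize u)) (tau (standardize v)))"
        using i sz t by simp
      from le[unfolded t node_le_join[OF i(1) this] su]
      consider "i \<le> length u" "j \<le> length u" "node_le (tau (standardize u)) i j"
        | "j = Suc (length u)"
        | "i > Suc (length u)" "j > Suc (length u)"
          "node_le (tau (standardize v)) (i - Suc (length u)) (j - Suc (length u))"
        by blast
      then show ?thesis
      proof cases
        case 1
        then have "standardize u ! (i - 1) \<le> standardize u ! (j - 1)"
          using IHu i by simp
        then have "u ! (i - 1) \<le> u ! (j - 1)"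
          using 1 i j by (subst (asm) standardize_mono) auto
        moreover have "i - 1 < length u" "j - 1 < length u" using 1 i j by auto
        ultimately show ?thesis unfolding w by (simp add: nth_append)
      next
        case 2
        then have "w ! (j - 1) = m" unfolding w by simp
        moreover have "w ! (i - 1) \<in> set w" using i by auto
        ultimately show ?thesis by (simp add: m_def)
      next
        case 3
        define a where "a = i - Suc (length u)"
        define b where "b = j - Suc (length u)"
        have ab: "1 \<le> a" "a \<le> length v" "1 \<le> b" "b \<le> length v"
          "i = Suc (length u) + a" "j = Suc (length u) + b"
          using 3 i j w by (auto simp: a_def b_def)
        have "node_le (tau (standardize v)) a b" using 3 by (simp add: a_def b_def)
        then have "standardize v ! (a - 1) \<le> standardize v ! (b - 1)"
          using IHv ab by simp
        then have "v ! (a - 1) \<le> v ! (b - 1)"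
          using ab by (subst (asm) standardize_mono) auto
        then show ?thesis using ab unfolding w by (simp add: nth_append nth_Cons')
      qed
    qed
    with sz show ?thesis by blast
  qed
qed

lemma tamari_le_size:
  assumes "tamari_le s t"
  shows "size s = size t"
proof -
  have c: "tamari_cover x y \<Longrightarrow> size x = size y" for x y
    by (induction rule: tamari_cover.induct) auto
  from assms show ?thesis
    unfolding tamari_le_def by (induction rule: rtranclp_induct) (auto dest: c)
qed

lemma tamari_le_antisym:
  assumes "tamari_le s t" "tamari_le t s"
  shows "s = t"
proof -
  define h :: "ptree \<Rightarrow> nat" where "h = rec_tree 0 (\<lambda>l _ r a b. a + b + size r)"
  have h: "h Leaf = 0" "h (join l r) = h l + h r + size r" for l r
    by (simp_all add: h_def)
  have "tamari_cover x y \<Longrightarrow> size x = size y \<and> h x < h y" for x y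
    by (induction rule: tamari_cover.induct) (auto simp: h)
  then have c: "tamari_cover x y \<Longrightarrow> h x < h y" for x y by blast
  have "tamari_le x y \<Longrightarrow> x = y \<or> h x < h y" for x y
    unfolding tamari_le_def by (induction rule: rtranclp_induct) (auto dest: c)
  from this[OF assms(1)] this[OF assms(2)] show ?thesis by auto
qed

lemma finite_ptrees: "finite {t :: ptree. size t \<le> n}"
proof (induction n)
  case 0
  have "{t :: ptree. size t \<le> 0} = {Leaf}" by auto
  then show ?case by simp
next
  case (Suc n)
  have "{t :: ptree. size t \<le> Suc n} \<subseteq>
    insert Leaf ((\<lambda>(l, r). join l r) ` ({t. size t \<le> n} \<times> {t. size t \<le> n}))"
  proof
    fix t :: ptree assume "t \<in> {t. size t \<le> Suc n}"
    then show "t \<in> insert Leaf ((\<lambda>(l, r). join l r) ` ({t. size t \<le> n} \<times> {t. size t \<le> n}))"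
      by (cases t) auto
  qed
  then show ?case by (rule finite_subset) (use Suc in auto)
qed


section \<open>Bi-leveled trees\<close>

definition is_bileveled :: "ptree \<Rightarrow> nat set \<Rightarrow> bool" where
  "is_bileveled t T \<longleftrightarrow>
     T \<subseteq> {1..size t} \<and>
     (\<forall>i \<in> T. \<forall>j. node_le t i j \<longrightarrow> j \<in> T) \<and>
     (t \<noteq> Leaf \<longrightarrow> 1 \<in> T \<and> (\<forall>i \<in> T. node_le t i 1 \<longrightarrow> i = 1))"

typedef bltree = "{(t, T). is_bileveled t T}"
  morphisms rep_bltree bltree
  by (rule exI[of _ "(Leaf, {})"]) (auto simp: is_bileveled_def)

text \<open>\<open>phi\<close> forgets the order ideal.\<close>

definition phi :: "bltree \<Rightarrow> ptree" where
  "phi b = fst (rep_bltree b)"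

definition ideal :: "bltree \<Rightarrow> nat set" where
  "ideal b = snd (rep_bltree b)"

lemma is_bileveled_phi_ideal: "is_bileveled (phi b) (ideal b)"
  using rep_bltree[of b] by (auto simp: phi_def ideal_def split: prod.splits)

lemma phi_ideal_bltree:
  "is_bileveled t T \<Longrightarrow> phi (bltree (t, T)) = t \<and> ideal (bltree (t, T)) = T"
  by (simp add: phi_def ideal_def bltree_inverse)

lemma bltree_eqI: "phi b = phi c \<Longrightarrow> ideal b = ideal c \<Longrightarrow> b = c"
  unfolding phi_def ideal_def by (metis prod.expand rep_bltree_inject)

text \<open>
  One order on all bi-leveled trees; comparable trees have the same number of nodes, so this is
  the disjoint union of the orders on trees with \<open>n\<close> nodes.
\<close>

instantiation bltree :: order
begin

definition less_eq_bltree :: "bltree \<Rightarrow> bltree \<Rightarrow> bool" where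
  "b \<le> c \<longleftrightarrow> tamari_le (phi b) (phi c) \<and> ideal c \<subseteq> ideal b"

definition less_bltree :: "bltree \<Rightarrow> bltree \<Rightarrow> bool" where
  "b < c \<longleftrightarrow> b \<le> c \<and> \<not> c \<le> (b :: bltree)"

instance
proof
  fix a b c :: bltree
  show "a < b \<longleftrightarrow> a \<le> b \<and> \<not> b \<le> a" by (rule less_bltree_def)
  show "a \<le> a" by (simp add: less_eq_bltree_def tamari_le_def)
  show "a \<le> b \<Longrightarrow> b \<le> c \<Longrightarrow> a \<le> c" by (auto simp: less_eq_bltree_def tamari_le_def)
  show "a \<le> b \<Longrightarrow> b \<le> a \<Longrightarrow> a = b"
    by (auto simp: less_eq_bltree_def intro: bltree_eqI tamari_le_antisym)
qed

end

lemma finite_bltrees: "finite {b. size (phi b) \<le> n}"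
proof -
  have "rep_bltree ` {b. size (phi b) \<le> n} \<subseteq> {t. size t \<le> n} \<times> Pow {1..n}"
  proof (rule image_subsetI)
    fix b assume "b \<in> {b. size (phi b) \<le> n}"
    with is_bileveled_phi_ideal[of b] have "phi b \<in> {t. size t \<le> n}" "ideal b \<in> Pow {1..n}"
      by (auto simp: is_bileveled_def)
    moreover have "rep_bltree b = (phi b, ideal b)" by (simp add: phi_def ideal_def)
    ultimately show "rep_bltree b \<in> {t. size t \<le> n} \<times> Pow {1..n}" by simp
  qed
  moreover have "finite ({t :: ptree. size t \<le> n} \<times> Pow {1..n})"
    using finite_ptrees by simp
  ultimately have "finite (rep_bltree ` {b. size (phi b) \<le> n})" by (rule finite_subset)
  then show ?thesis
    by (rule finite_imageD) (auto simp: inj_on_def rep_bltree_inject)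
qed

lemma finite_atLeast_bltree: "finite {b :: bltree ..}"
proof (rule finite_subset[OF _ finite_bltrees[of "size (phi b)"]])
  show "{b..} \<subseteq> {c. size (phi c) \<le> size (phi b)}"
    using tamari_le_size[of "phi b"] by (fastforce simp: less_eq_bltree_def)
qed

definition beta :: "nat list \<Rightarrow> bltree" where
  "beta w = bltree (tau w, {i \<in> {1..length w}. w ! 0 \<le> w ! (i - 1)})"

lemma phi_ideal_beta:
  assumes "distinct w"
  shows "phi (beta w) = tau w \<and> ideal (beta w) = {i \<in> {1..length w}. w ! 0 \<le> w ! (i - 1)}"
  unfolding beta_def
proof (rule phi_ideal_bltree)
  let ?T = "{i \<in> {1..length w}. w ! 0 \<le> w ! (i - 1)}"
  have sz: "size (tau w) = length w" using size_tau_node_le by blast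
  have le: "w ! (i - 1) \<le> w ! (j - 1)"
    if "1 \<le> i" "i \<le> length w" "node_le (tau w) i j" for i j
    using size_tau_node_le that by blast
  show "is_bileveled (tau w) ?T"
    unfolding is_bileveled_def
  proof (intro conjI ballI allI impI)
    show "?T \<subseteq> {1..size (tau w)}" using sz by auto
    show "j \<in> ?T" if "i \<in> ?T" "node_le (tau w) i j" for i j
      using that node_le_bounds[OF that(2)] le[of i j] sz by auto
  next
    assume "tau w \<noteq> Leaf"
    then show "1 \<in> ?T" using sz by (cases w) (auto simp: tau.simps)
  next
    fix i assume i: "i \<in> ?T" "node_le (tau w) i 1"
    then have "w ! (i - 1) = w ! 0" using le[of i 1] by auto
    then have "i - 1 = 0" using i assms by (subst (asm) nth_eq_iff_index_eq) auto
    with i show "i = 1" by auto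
  qed
qed

text \<open>\<open>c\<close> must have at least one node here; otherwise \<open>1\<close> need not lie in the order ideal.\<close>

definition backslash :: "bltree \<Rightarrow> ptree \<Rightarrow> bltree" where
  "backslash c s = bltree (graft_right (phi c) s, ideal c)"

lemma phi_ideal_backslash:
  assumes "phi c \<noteq> Leaf"
  shows "phi (backslash c s) = graft_right (phi c) s \<and> ideal (backslash c s) = ideal c"
  unfolding backslash_def
proof (rule phi_ideal_bltree)
  show "is_bileveled (graft_right (phi c) s) (ideal c)"
    using is_bileveled_phi_ideal[of c] assms unfolding is_bileveled_def
    by (fastforce simp: node_le_graft_right subset_iff)
qed

definition indecomposables :: "bltree set" where
  "indecomposables =
     {b. phi b \<noteq> Leaf \<and> (\<forall>c s. phi c \<noteq> Leaf \<and> b = backslash c s \<longrightarrow> c = b \<and> s = Leaf)}"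

definition B' :: "bltree set" where
  "B' = {b. phi b = Leaf} \<union> {b \<in> indecomposables. \<not> (\<exists>t. t \<noteq> Leaf \<and> b = beta (max_perm t))}"

text \<open>
  If \<open>b\<close> splits along leaf \<open>i\<close> into \<open>b\<^sub>0\<close> and \<open>b\<^sub>1\<close>, then \<open>left_part b i\<close> is \<open>b\<^sub>0\<close> and
  \<open>snd (split_tree (phi b) i)\<close> is the tree underlying \<open>b\<^sub>1\<close>; the order ideal of \<open>b\<^sub>1\<close> is not needed.
\<close>

definition left_part :: "bltree \<Rightarrow> nat \<Rightarrow> bltree" where
  "left_part b i = bltree (fst (split_tree (phi b) i), ideal b \<inter> {1..i})"

lemma phi_ideal_left_part:
  assumes "i \<le> size (phi b)"
  shows "phi (left_part b i) = fst (split_tree (phi b) i) \<and> ideal (left_part b i) = ideal b \<inter> {1..i}"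
  unfolding left_part_def
proof (rule phi_ideal_bltree)
  let ?t = "fst (split_tree (phi b) i)"
  have sz: "size ?t = i" using size_split_tree[OF assms] by simp
  note b = is_bileveled_phi_ideal[of b, unfolded is_bileveled_def]
  note le = node_le_split_tree[OF assms]
  show "is_bileveled ?t (ideal b \<inter> {1..i})"
    unfolding is_bileveled_def
  proof (intro conjI ballI allI impI)
    show "ideal b \<inter> {1..i} \<subseteq> {1..size ?t}" using sz by auto
    show "k \<in> ideal b \<inter> {1..i}" if j: "j \<in> ideal b \<inter> {1..i}" and jk: "node_le ?t j k" for j k
    proof -
      have k: "1 \<le> k" "k \<le> i" using node_le_bounds[OF jk] j sz by auto
      then have "node_le (phi b) j k" using le[of j k] j jk by auto
      then show ?thesis using b j k by auto
    qed
  next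
    assume "?t \<noteq> Leaf"
    then have i: "1 \<le> i" using sz by (cases i) auto
    then have ne: "phi b \<noteq> Leaf" using assms by auto
    show "1 \<in> ideal b \<inter> {1..i}" using b ne i by auto
    show "j = 1" if "j \<in> ideal b \<inter> {1..i}" "node_le ?t j 1" for j
      using that le[of j 1] b ne i by auto
  qed
qed

function mobius :: "bltree \<Rightarrow> bltree \<Rightarrow> int" where
  "mobius b c = (if b = c then 1 else if b < c then - (\<Sum>x \<in> {b..<c}. mobius b x) else 0)"
  by auto
termination
proof (relation "measure (\<lambda>(b, c). card {b..c})", goal_cases)
  case 1 show ?case by simp
next
  case (2 b c x)
  have "{b..x} \<subset> {b..c}"
  proof
    show "{b..x} \<subseteq> {b..c}" using 2 by auto
    have "c \<in> {b..c}" "c \<notin> {b..x}" using 2 by auto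
    then show "{b..x} \<noteq> {b..c}" by blast
  qed
  moreover have "finite {b..c}"
    by (rule finite_subset[OF _ finite_atLeast_bltree[of b]]) auto
  ultimately show ?case using psubset_card_mono by simp
qed

declare mobius.simps [simp del]


section \<open>The vector spaces and the coaction\<close>

text \<open>
  The rational vector space with basis \<open>F x\<close>, for \<open>x\<close> of type \<open>'a\<close>, is the type \<open>'a \<Rightarrow>\<^sub>0 rat\<close>
  of finitely supported functions.
\<close>

type_synonym MSym = "bltree \<Rightarrow>\<^sub>0 rat"
type_synonym YSym = "ptree \<Rightarrow>\<^sub>0 rat"

abbreviation (input) lookup where "lookup \<equiv> Poly_Mapping.lookup"
abbreviation (input) keys where "keys \<equiv> Poly_Mapping.keys"
abbreviation (input) single where "single \<equiv> Poly_Mapping.single"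

abbreviation F :: "'a \<Rightarrow> 'a \<Rightarrow>\<^sub>0 rat" where
  "F x \<equiv> single x 1"

definition scl :: "rat \<Rightarrow> ('a \<Rightarrow>\<^sub>0 rat) \<Rightarrow> ('a \<Rightarrow>\<^sub>0 rat)" where
  "scl a v = Poly_Mapping.map ((*) a) v"

lemma lookup_scl [simp]: "lookup (scl a v) x = a * lookup v x"
  by (simp add: scl_def Poly_Mapping.map.rep_eq when_def)

global_interpretation rvec: vector_space scl
  by unfold_locales (auto intro!: poly_mapping_eqI simp: lookup_add algebra_simps)

text \<open>
  The tensor product of the spaces with bases \<open>'a\<close> and \<open>'b\<close> is the space with basis
  \<open>'a \<times> 'b\<close>, where the pair \<open>(x, y)\<close> stands for the tensor product of \<open>F x\<close> and \<open>F y\<close>.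
\<close>

definition tensor :: "('a \<Rightarrow>\<^sub>0 rat) \<Rightarrow> ('b \<Rightarrow>\<^sub>0 rat) \<Rightarrow> ('a \<times> 'b \<Rightarrow>\<^sub>0 rat)" (infixl \<open>\<otimes>\<close> 70) where
  "u \<otimes> v = (\<Sum>x \<in> keys u. \<Sum>y \<in> keys v. single (x, y) (lookup u x * lookup v y))"

lemma lookup_tensor: "lookup (u \<otimes> v) (x, y) = lookup u x * lookup v y"
proof -
  have "lookup (u \<otimes> v) (x, y) =
      (\<Sum>a \<in> keys u. \<Sum>b \<in> keys v. if a = x \<and> b = y then lookup u x * lookup v y else 0)"
    unfolding tensor_def lookup_sum
    by (intro sum.cong refl) (auto simp: lookup_single when_def)
  also have "\<dots> = (\<Sum>a \<in> keys u. if a = x then lookup u x * lookup v y else 0)"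
    by (intro sum.cong refl) (auto simp: in_keys_iff)
  also have "\<dots> = lookup u x * lookup v y"
    by (auto simp: in_keys_iff)
  finally show ?thesis .
qed

lemma tensor_F: "F x \<otimes> F y = F (x, y)"
  by (simp add: tensor_def)

definition rho_F :: "bltree \<Rightarrow> (bltree \<times> ptree \<Rightarrow>\<^sub>0 rat)" where
  "rho_F b = (\<Sum>i\<le>size (phi b). F (left_part b i) \<otimes> F (snd (split_tree (phi b) i)))"

definition rho :: "MSym \<Rightarrow> (bltree \<times> ptree \<Rightarrow>\<^sub>0 rat)" where
  "rho m = (\<Sum>b \<in> keys m. scl (lookup m b) (rho_F b))"

lemma rho_basis: "rho (F b) = rho_F b"
  by (simp add: rho_def)

lemma linear_rho: "Vector_Spaces.linear scl scl rho"
proof unfold_locales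
  have sup: "rho m = (\<Sum>b \<in> A. scl (lookup m b) (rho_F b))"
    if "finite A" "keys m \<subseteq> A" for m A
    unfolding rho_def
    by (rule sum.mono_neutral_left) (use that in \<open>auto simp: in_keys_iff\<close>)
  show "rho (u + v) = rho u + rho v" for u v
  proof -
    let ?A = "keys u \<union> keys v"
    have "keys (u + v) \<subseteq> ?A" by (rule Poly_Mapping.keys_add)
    then show ?thesis
      by (simp add: sup[of ?A] lookup_add rvec.scale_left_distrib sum.distrib)
  qed
  show "rho (scl a v) = scl a (rho v)" for a v
  proof -
    have "keys (scl a v) \<subseteq> keys v" by (auto simp: in_keys_iff)
    then show ?thesis
      by (simp add: sup[of "keys v"] rvec.scale_sum_right)
  qed
qed

definition M :: "bltree \<Rightarrow> MSym" where
  "M b = (\<Sum>c \<in> {b..}. scl (of_int (mobius b c)) (F c))"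

definition coinvariants :: "MSym set" where
  "coinvariants = {m. rho m = m \<otimes> F Leaf}"

end

theory Submission
  imports Defs
begin

text \<open>
  The elements \<^term>\<open>M b\<close> form a basis of the whole space, and by Moebius inversion the coefficient
  of \<^term>\<open>M c\<close> in \<open>m\<close> is the lower sum of the coefficients that \<open>m\<close> has at the \<^term>\<open>F b\<close> with
  \<open>b \<le> c\<close>. So it suffices to see which lower sums vanish on coinvariants (\<open>span_M_iff\<close>).

  Lower sums also separate the points of the tensor product, for the product order on its basis
  (\<open>lower_sum_inject\<close>), and they turn the coaction into a mere reindexing. Splitting is adjoint
  to grafting: \<open>b \<le> c \ s\<close> holds iff splitting \<open>b\<close> along the leaf with number \<open>|c|\<close> yields parts
  below \<open>c\<close> and \<open>s\<close> (\<open>tamari_le_graft_right_iff\<close>, \<open>le_extend_iff\<close>). Hence the lower sum of \<open>\<rho>(m)\<close>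
  at \<open>(c, s)\<close> is the lower sum of \<open>m\<close> at \<open>c \ s\<close>. For \<open>c = |\<close> the role of \<open>c \ s\<close> is played by the
  largest bi-leveled tree over \<open>s\<close>, which is \<^term>\<open>beta (max_perm s)\<close>; this is where the elements
  removed from the indecomposables come from.

  On the other side, the lower sum of \<open>m \<otimes> 1\<close> at \<open>(c, s)\<close> is the one of \<open>m\<close> at \<open>c\<close> if \<open>s = |\<close>, and
  zero otherwise. For \<open>s = |\<close> the two sides always agree, so \<open>m\<close> is coinvariant iff its lower sums
  vanish at all \<open>c \ s\<close> with \<open>s \<noteq> |\<close> (\<open>coinvariants_iff\<close>). These trees are exactly the ones outside
  \<^term>\<open>B'\<close> (\<open>not_in_B'_iff\<close>).
\<close>

section \<open>Lower sums\<close>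

text \<open>
  The order is a parameter because the sums are taken both over bi-leveled trees and over the basis
  of the tensor product.
\<close>

definition lower_sum :: "('a \<Rightarrow> 'a \<Rightarrow> bool) \<Rightarrow> 'a \<Rightarrow> ('a \<Rightarrow>\<^sub>0 rat) \<Rightarrow> rat" where
  "lower_sum le c m = (\<Sum>b \<in> keys m. if le b c then lookup m b else 0)"

lemma lower_sum_superset:
  assumes "finite A" "keys m \<subseteq> A"
  shows "lower_sum le c m = (\<Sum>b \<in> A. if le b c then lookup m b else 0)"
  unfolding lower_sum_def
  by (rule sum.mono_neutral_left) (use assms in \<open>auto simp: in_keys_iff\<close>)

lemma lower_sum_zero [simp]: "lower_sum le c 0 = 0"
  by (simp add: lower_sum_def)

lemma lower_sum_F [simp]: "lower_sum le c (F b) = of_bool (le b c)"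
  by (simp add: lower_sum_def)

lemma lower_sum_add: "lower_sum le c (u + v) = lower_sum le c u + lower_sum le c v"
proof -
  let ?A = "keys u \<union> keys v"
  have "keys (u + v) \<subseteq> ?A" by (rule Poly_Mapping.keys_add)
  then have "lower_sum le c (u + v) = (\<Sum>b \<in> ?A. if le b c then lookup (u + v) b else 0)"
    by (intro lower_sum_superset) auto
  also have "\<dots> = (\<Sum>b \<in> ?A. if le b c then lookup u b else 0)
      + (\<Sum>b \<in> ?A. if le b c then lookup v b else 0)"
    unfolding sum.distrib [symmetric] by (intro sum.cong) (auto simp: lookup_add)
  finally show ?thesis by (simp add: lower_sum_superset [of ?A])
qed

lemma lower_sum_scl: "lower_sum le c (scl a v) = a * lower_sum le c v"
proof -
  have "keys (scl a v) \<subseteq> keys v" by (auto simp: in_keys_iff)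
  then show ?thesis
    by (simp add: lower_sum_superset [of "keys v"] sum_distrib_left if_distrib cong: if_cong)
qed

lemma lower_sum_sum: "lower_sum le c (\<Sum>x \<in> A. f x) = (\<Sum>x \<in> A. lower_sum le c (f x))"
  by (induction A rule: infinite_finite_induct) (auto simp: lower_sum_add)

lemma lower_sum_diff: "lower_sum le c (u - v) = lower_sum le c u - lower_sum le c v"
  using lower_sum_add [of le c "u - v" v] by simp

text \<open>At a minimal element of the support only one summand is left.\<close>

lemma lower_sum_eq_0_imp:
  assumes le: "reflp le" "antisymp le" "transp le"
    and zero: "\<And>c. lower_sum le c m = 0"
  shows "m = 0"
proof (rule ccontr)
  assume "m \<noteq> 0"
  then have ne: "keys m \<noteq> {}" by simp
  let ?lt = "\<lambda>x y. le x y \<and> x \<noteq> y"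
  have "\<exists>c \<in> keys m. \<forall>b \<in> keys m. b \<noteq> c \<longrightarrow> \<not> ?lt b c"
    by (rule Finite_Set.bex_min_element)
      (use le ne in \<open>auto simp: asymp_on_def transp_on_def antisymp_on_def dest: transpD antisympD\<close>)
  then obtain c where c: "c \<in> keys m" and min: "\<And>b. b \<in> keys m \<Longrightarrow> b \<noteq> c \<Longrightarrow> \<not> le b c"
    by blast
  have "lower_sum le c m = (\<Sum>b \<in> keys m. if b = c then lookup m b else 0)"
    unfolding lower_sum_def using min reflpD [OF le(1)] by (intro sum.cong) auto
  also have "\<dots> = lookup m c" using c by simp
  finally show False using c zero by (simp add: in_keys_iff)
qed

lemma lower_sum_inject:
  assumes "reflp le" "antisymp le" "transp le" "\<And>c. lower_sum le c u = lower_sum le c v"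
  shows "u = v"
proof -
  have "u - v = 0" by (rule lower_sum_eq_0_imp [OF assms(1-3)]) (simp add: lower_sum_diff assms(4))
  then show ?thesis by simp
qed


section \<open>The basis of the elements \<open>M b\<close>\<close>

text \<open>
  This is the defining recursion of the Moebius function: its values sum to zero over
  every interval that has more than one element.
\<close>

lemma lower_sum_M: "lower_sum (\<le>) c (M b) = of_bool (b = c)"
proof -
  have fin: "finite {b..}" by (rule finite_atLeast_bltree)
  have fin': "finite {b..<c}" by (rule finite_subset [OF _ fin]) auto
  have "lower_sum (\<le>) c (M b) = (\<Sum>x \<in> {b..}. if x \<le> c then of_int (mobius b x) else 0)"
    unfolding M_def by (auto simp: lower_sum_sum lower_sum_scl intro!: sum.cong)
  also have "\<dots> = (\<Sum>x \<in> {x \<in> {b..}. x \<le> c}. of_int (mobius b x))"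
    using fin by (rule sum.inter_filter [symmetric])
  also have "{x \<in> {b..}. x \<le> c} = {b..c}" by auto
  also have "(\<Sum>x \<in> {b..c}. of_int (mobius b x)) = (of_bool (b = c) :: rat)"
  proof (cases "b < c")
    case True
    then have "{b..c} = insert c {b..<c}" by auto
    then show ?thesis using True fin' by (simp add: mobius.simps [of b c])
  next
    case False
    moreover have "mobius b b = 1" by (subst mobius.simps) simp
    ultimately show ?thesis by (cases "b = c") auto
  qed
  finally show ?thesis .
qed

lemma inj_M: "inj M"
proof (rule injI)
  fix b c assume "M b = M c"
  then have "lower_sum (\<le>) c (M b) = lower_sum (\<le>) c (M c)" by simp
  then show "b = c" by (simp add: lower_sum_M split: if_splits)
qed

text \<open>
  Lower sums are the coordinates for the elements \<^term>\<open>M c\<close>; only finitely many of them are nonzero,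
  since every element has finitely many upper bounds.
\<close>

lemma span_M_iff: "m \<in> rvec.span (M ` A) \<longleftrightarrow> (\<forall>c. c \<notin> A \<longrightarrow> lower_sum (\<le>) c m = 0)"
proof
  assume "m \<in> rvec.span (M ` A)"
  then show "\<forall>c. c \<notin> A \<longrightarrow> lower_sum (\<le>) c m = 0"
  proof (induction rule: rvec.span_induct_alt)
    case base show ?case by simp
  next
    case (step a x y) then show ?case
      by (auto simp: lower_sum_add lower_sum_scl lower_sum_M)
  qed
next
  assume zero: "\<forall>c. c \<notin> A \<longrightarrow> lower_sum (\<le>) c m = 0"
  define C where "C = {c. lower_sum (\<le>) c m \<noteq> 0}"
  have "C \<subseteq> (\<Union>b \<in> keys m. {b..})"
  proof
    fix c assume "c \<in> C"
    then have "(\<Sum>b \<in> keys m. if b \<le> c then lookup m b else 0) \<noteq> 0"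
      by (simp add: C_def lower_sum_def)
    then obtain b where "b \<in> keys m" "(if b \<le> c then lookup m b else 0) \<noteq> 0"
      by (rule sum.not_neutral_contains_not_neutral)
    then show "c \<in> (\<Union>b \<in> keys m. {b..})" by (auto split: if_splits)
  qed
  then have fin: "finite C"
    by (rule finite_subset) (simp add: finite_atLeast_bltree)
  have "m = (\<Sum>c \<in> C. scl (lower_sum (\<le>) c m) (M c))"
  proof (rule lower_sum_inject [of "(\<le>)"])
    fix c
    have "lower_sum (\<le>) c (\<Sum>c \<in> C. scl (lower_sum (\<le>) c m) (M c))
        = (\<Sum>x \<in> C. if x = c then lower_sum (\<le>) c m else 0)"
      by (auto simp: lower_sum_sum lower_sum_scl lower_sum_M intro!: sum.cong)
    also have "\<dots> = lower_sum (\<le>) c m" using fin by (simp add: C_def)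
    finally show "lower_sum (\<le>) c m = lower_sum (\<le>) c (\<Sum>c \<in> C. scl (lower_sum (\<le>) c m) (M c))"
      by simp
  qed auto
  moreover have "C \<subseteq> A" using zero by (auto simp: C_def)
  then have "(\<Sum>c \<in> C. scl (lower_sum (\<le>) c m) (M c)) \<in> rvec.span (M ` A)"
    by (intro rvec.span_sum rvec.span_scale rvec.span_base) auto
  ultimately show "m \<in> rvec.span (M ` A)" by simp
qed

lemma independent_M: "rvec.independent (M ` A)"
  unfolding rvec.dependent_def
proof (clarify)
  fix b assume "b \<in> A" and "M b \<in> rvec.span (M ` A - {M b})"
  moreover have "M ` A - {M b} = M ` (A - {b})" using inj_M by (auto dest: injD)
  ultimately show False by (auto simp: span_M_iff lower_sum_M)
qed


section \<open>Splitting and grafting in the Tamari order\<close>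

lemma tamari_le_refl [simp]: "tamari_le t t"
  by (simp add: tamari_le_def)

lemma tamari_le_trans [trans]: "tamari_le s t \<Longrightarrow> tamari_le t u \<Longrightarrow> tamari_le s u"
  by (simp add: tamari_le_def)

lemma tamari_le_induct [consumes 1, case_names refl step]:
  assumes "tamari_le s t" "P s" "\<And>u v. tamari_le s u \<Longrightarrow> tamari_cover u v \<Longrightarrow> P u \<Longrightarrow> P v"
  shows "P t"
  using assms unfolding tamari_le_def by (rule rtranclp_induct)

lemma tamari_cover_le: "tamari_cover s t \<Longrightarrow> tamari_le s t"
  by (simp add: tamari_le_def)

lemma tamari_le_join:
  assumes "tamari_le l l'" "tamari_le r r'"
  shows "tamari_le (join l r) (join l' r')"
proof -
  have "tamari_le (join l r) (join l' r)"
    using assms(1) unfolding tamari_le_def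
    by (induction rule: rtranclp_induct) (auto intro: rtranclp.rtrancl_into_rtrancl in_left)
  also have "tamari_le (join l' r) (join l' r')"
    using assms(2) unfolding tamari_le_def
    by (induction rule: rtranclp_induct) (auto intro: rtranclp.rtrancl_into_rtrancl in_right)
  finally show ?thesis .
qed

lemma tamari_le_graft_right_mono:
  assumes "tamari_le s s'"
  shows "tamari_le (graft_right c s) (graft_right c s')"
  using assms by (induction c) (auto intro: tamari_le_join)

lemma tamari_cover_graft_right:
  "tamari_cover c c' \<Longrightarrow> tamari_le (graft_right c s) (graft_right c' s)"
  by (induction rule: tamari_cover.induct)
    (auto intro: tamari_le_join tamari_cover_le tamari_cover.intros)

lemma tamari_le_graft_right:
  assumes "tamari_le c c'" "tamari_le s s'"
  shows "tamari_le (graft_right c s) (graft_right c' s')"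
proof -
  have "tamari_le (graft_right c s) (graft_right c' s)"
    using assms(1)
    by (induction rule: tamari_le_induct) (blast intro: tamari_le_refl tamari_le_trans tamari_cover_graft_right)+
  also have "tamari_le \<dots> (graft_right c' s')" by (rule tamari_le_graft_right_mono [OF assms(2)])
  finally show ?thesis .
qed

text \<open>Rotating once at each node on the right spine of \<open>x\<close> moves \<open>z\<close> to the end of that spine.\<close>

lemma tamari_le_join_graft_right:
  "tamari_le (join (graft_right x y) z) (graft_right x (join y z))"
proof (induction x)
  case Leaf show ?case by simp
next
  case (Node a u b)
  have "tamari_le (join (graft_right (Node a u b) y) z) (join a (join (graft_right b y) z))"
    by (simp add: tamari_cover_le tamari_cover.rotate)
  also have "tamari_le \<dots> (join a (graft_right b (join y z)))"
    using Node.IH(2) by (intro tamari_le_join) auto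
  finally show ?case by simp
qed

lemma tamari_le_graft_split:
  "i \<le> size t \<Longrightarrow> tamari_le t (graft_right (fst (split_tree t i)) (snd (split_tree t i)))"
proof (induction t arbitrary: i)
  case Leaf show ?case by simp
next
  case (Node l u r)
  show ?case
  proof (cases "i \<le> size l")
    case True
    obtain l0 l1 where l: "split_tree l i = (l0, l1)" by fastforce
    have "tamari_le (Node l u r) (join (graft_right l0 l1) r)"
      using Node.IH(1) [OF True] l by (auto intro: tamari_le_join)
    also have "tamari_le \<dots> (graft_right l0 (join l1 r))"
      by (rule tamari_le_join_graft_right)
    finally show ?thesis using True l by simp
  next
    case False
    obtain r0 r1 where r: "split_tree r (i - Suc (size l)) = (r0, r1)" by fastforce
    have "i - Suc (size l) \<le> size r" using Node.prems by simp
    from Node.IH(2) [OF this] show ?thesis using False r by (auto intro: tamari_le_join)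
  qed
qed

lemma split_tree_graft_right: "split_tree (graft_right c s) (size c) = (c, s)"
proof (induction c)
  case Leaf
  show ?case by (induction s) auto
next
  case (Node l u r) then show ?case by simp
qed

lemma split_tree_0: "split_tree t 0 = (Leaf, t)"
  using split_tree_graft_right [of Leaf t] by simp

lemma tamari_cover_size: "tamari_cover s t \<Longrightarrow> size s = size t"
  by (rule tamari_le_size [OF tamari_cover_le])

text \<open>
  A cut through a rotated subtree either separates the two nodes that take part in the rotation, and
  then both trees have the same parts, or it leaves the rotation within one of the parts.
\<close>

lemma tamari_cover_split_tree:
  assumes "tamari_cover s t"
  shows "tamari_le (fst (split_tree s i)) (fst (split_tree t i)) \<and>
    tamari_le (snd (split_tree s i)) (snd (split_tree t i))"
  using assms
proof (induction arbitrary: i rule: tamari_cover.induct)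
  case (rotate x y z)
  consider "i \<le> size x" | "size x < i" "i - Suc (size x) \<le> size y"
    | "size x < i" "size y < i - Suc (size x)" by linarith
  then show ?case
  proof cases
    case 1
    then show ?thesis
      by (cases "split_tree x i") (simp add: tamari_cover_le tamari_cover.rotate)
  next
    case 2
    then have "i \<le> Suc (size x + size y)" by simp
    with 2 show ?thesis by (cases "split_tree y (i - Suc (size x))") simp
  next
    case 3
    then have "\<not> i \<le> Suc (size x + size y)" by simp
    with 3 show ?thesis
      by (cases "split_tree z (i - Suc (Suc (size x + size y)))")
        (simp add: tamari_cover_le tamari_cover.rotate)
  qed
next
  case (in_left l l' r)
  have "size l = size l'" by (rule tamari_cover_size [OF in_left.hyps])
  then show ?case using in_left.IH [of i] tamari_cover_le [OF in_left.hyps]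
    by (cases "split_tree l i"; cases "split_tree l' i"; cases "split_tree r (i - Suc (size l'))")
      (auto intro: tamari_le_join)
next
  case (in_right r r' l)
  then show ?case using in_right.IH [of "i - Suc (size l)"] tamari_cover_le [OF in_right.hyps]
    by (cases "split_tree r (i - Suc (size l))"; cases "split_tree r' (i - Suc (size l))";
        cases "split_tree l i") (auto intro: tamari_le_join)
qed

lemma tamari_le_split_tree:
  assumes "tamari_le s t"
  shows "tamari_le (fst (split_tree s i)) (fst (split_tree t i)) \<and>
    tamari_le (snd (split_tree s i)) (snd (split_tree t i))"
  using assms
proof (induction rule: tamari_le_induct)
  case refl show ?case by simp
next
  case (step u v)
  then show ?case using tamari_cover_split_tree [OF step(2), of i] by (blast intro: tamari_le_trans)
qed

text \<open>
  The adjunction between splitting and grafting: both are monotone, splitting undoes grafting, and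
  splitting followed by grafting only moves a tree up.
\<close>

theorem tamari_le_graft_right_iff:
  assumes "size c \<le> size t"
  shows "tamari_le t (graft_right c s) \<longleftrightarrow>
    tamari_le (fst (split_tree t (size c))) c \<and> tamari_le (snd (split_tree t (size c))) s"
proof
  assume "tamari_le t (graft_right c s)"
  from tamari_le_split_tree [OF this, of "size c"]
  show "tamari_le (fst (split_tree t (size c))) c \<and> tamari_le (snd (split_tree t (size c))) s"
    by (simp add: split_tree_graft_right)
next
  assume R: "tamari_le (fst (split_tree t (size c))) c \<and> tamari_le (snd (split_tree t (size c))) s"
  have "tamari_le t (graft_right (fst (split_tree t (size c))) (snd (split_tree t (size c))))"
    by (rule tamari_le_graft_split [OF assms])
  also have "tamari_le \<dots> (graft_right c s)"
    using R by (intro tamari_le_graft_right) auto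
  finally show "tamari_le t (graft_right c s)" .
qed


section \<open>The left spine\<close>

text \<open>
  The ancestors of node 1, including node 1 itself. They form the smallest order ideal that makes a
  tree bi-leveled, and rotations can only shrink this set.
\<close>

fun left_spine :: "ptree \<Rightarrow> nat set" where
  "left_spine Leaf = {}"
| "left_spine (Node l _ r) = insert (Suc (size l)) (left_spine l)"

lemma left_spine_subset: "left_spine t \<subseteq> {1..size t}"
  by (induction t) auto

lemma node_le_left_spine: "i \<in> left_spine t \<Longrightarrow> node_le t 1 i"
proof (induction t)
  case Leaf then show ?case by simp
next
  case (Node l u r)
  then show ?case using left_spine_subset [of l] by (subst node_le_join) auto
qed

lemma left_spine_subset_ideal: "left_spine (phi b) \<subseteq> ideal b"
  using is_bileveled_phi_ideal [of b] node_le_left_spine [of _ "phi b"]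
  unfolding is_bileveled_def by (cases "phi b = Leaf") auto

lemma left_spine_antimono:
  assumes "tamari_le s t"
  shows "left_spine t \<subseteq> left_spine s"
proof -
  have cover: "tamari_cover s t \<Longrightarrow> left_spine t \<subseteq> left_spine s" for s t
    by (induction rule: tamari_cover.induct) (auto dest: tamari_cover_size)
  from assms show ?thesis by (induction rule: tamari_le_induct) (use cover in auto)
qed


section \<open>The maximum of a fiber of \<open>tau\<close>\<close>

text \<open>
  Both \<^term>\<open>standardize\<close> and \<^term>\<open>tau\<close> see only the relative order of the letters. This removes
  the standardizations from the recursion for \<^term>\<open>tau\<close>.
\<close>

lemma standardize_map:
  assumes "strict_mono_on (set w) f"
  shows "standardize (map f w) = standardize w"
proof -
  have "card {y \<in> f ` set w. y \<le> f x} = card {y \<in> set w. y \<le> x}" if "x \<in> set w" for x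
  proof -
    have "{y \<in> f ` set w. y \<le> f x} = f ` {y \<in> set w. y \<le> x}"
      using that assms by (auto simp: strict_mono_on_less_eq)
    moreover have "inj_on f {y \<in> set w. y \<le> x}"
      using strict_mono_on_imp_inj_on [OF assms] by (rule inj_on_subset) auto
    ultimately show ?thesis by (simp add: card_image)
  qed
  then show ?thesis by (simp add: standardize_def)
qed

lemma tau_map:
  assumes "strict_mono_on (set w) f"
  shows "tau (map f w) = tau w"
proof (cases "w = []")
  case False
  define m where "m = Max (set w)"
  have m: "m \<in> set w" using False by (simp add: m_def)
  have inj: "inj_on f (set w)" by (rule strict_mono_on_imp_inj_on [OF assms])
  have Max: "Max (f ` set w) = f m"
  proof (rule Max_eqI)
    fix y assume "y \<in> f ` set w"
    then obtain x where x: "x \<in> set w" "y = f x" by auto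
    then have "x \<le> m" by (simp add: m_def)
    then show "y \<le> f m" using x m assms by (simp add: strict_mono_on_less_eq)
  qed (use m in auto)
  have eq: "f x \<noteq> f m \<longleftrightarrow> x \<noteq> m" if "x \<in> set w" for x
    using that m inj by (auto dest: inj_onD)
  have 1: "takeWhile (\<lambda>x. x \<noteq> f m) (map f w) = map f (takeWhile (\<lambda>x. x \<noteq> m) w)"
    using eq by (simp add: takeWhile_map comp_def cong: takeWhile_cong)
  have 2: "tl (dropWhile (\<lambda>x. x \<noteq> f m) (map f w)) = map f (tl (dropWhile (\<lambda>x. x \<noteq> m) w))"
    using eq by (simp add: dropWhile_map comp_def map_tl cong: dropWhile_cong)
  have "strict_mono_on (set (takeWhile (\<lambda>x. x \<noteq> m) w)) f"
    using assms by (rule monotone_on_subset) (auto dest: set_takeWhileD)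
  moreover have "strict_mono_on (set (tl (dropWhile (\<lambda>x. x \<noteq> m) w))) f"
    using assms
    by (rule monotone_on_subset) (metis list.set_sel(2) set_dropWhileD subsetI tl_Nil)
  ultimately show ?thesis
    using False
    by (simp add: tau.simps [of "map f w"] tau.simps [of w] Let_def Max m_def [symmetric]
        1 2 standardize_map)
qed simp

lemma tau_standardize: "tau (standardize w) = tau w"
  unfolding standardize_def
proof (rule tau_map, rule strict_mono_onI)
  fix x y assume "x \<in> set w" "y \<in> set w" "x < y"
  then have "{z \<in> set w. z \<le> x} \<subseteq> {z \<in> set w. z \<le> y}"
    "y \<in> {z \<in> set w. z \<le> y}" "y \<notin> {z \<in> set w. z \<le> x}"
    by auto
  then have "{z \<in> set w. z \<le> x} \<subset> {z \<in> set w. z \<le> y}" by blast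
  then show "card {z \<in> set w. z \<le> x} < card {z \<in> set w. z \<le> y}"
    by (intro psubset_card_mono) auto
qed

lemma tau_append:
  assumes "\<forall>x \<in> set u \<union> set v. x < m"
  shows "tau (u @ m # v) = join (tau u) (tau v)"
proof -
  have "Max (set (u @ m # v)) = m" using assms by (intro Max_eqI) (auto intro: less_imp_le)
  moreover have "takeWhile (\<lambda>x. x \<noteq> m) (u @ m # v) = u"
    "dropWhile (\<lambda>x. x \<noteq> m) (u @ m # v) = m # v"
    using assms by (auto simp: takeWhile_append dropWhile_append)
  ultimately show ?thesis
    by (subst tau.simps) (simp add: Let_def tau_standardize)
qed

text \<open>
  A cover raises the first letter that it changes. So it moves words up lexicographically, which
  makes the weak order antisymmetric.
\<close>

lemma weak_cover_distinct:
  assumes "weak_cover v w"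
  shows "set w = set v" "distinct v \<Longrightarrow> distinct w"
    "distinct v \<Longrightarrow> (v, w) \<in> lexord {(x, y). x < y}"
proof -
  from assms obtain i j k where ij: "i < j" "j < length v" "v ! i = k" "v ! j = Suc k"
    and w: "w = map (transpose k (Suc k)) v"
    by (auto elim: weak_cover.cases)
  have "k \<in> set v" "Suc k \<in> set v" using ij nth_mem by (metis less_trans)+
  then show "set w = set v" using w by (simp add: transpose_image_eq)
  show "distinct w" if "distinct v" 
    using that by (simp add: w distinct_map)
  show "(v, w) \<in> lexord {(x, y). x < y}" if d: "distinct v"
  proof -
    have v: "v = take i v @ k # drop (Suc i) v"
      using ij by (metis id_take_nth_drop less_trans)
    have "x \<noteq> k" "x \<noteq> Suc k" if "x \<in> set (take i v)" for x
    proof -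
      from that obtain p where p: "p < i" "x = v ! p" using ij by (auto simp: in_set_conv_nth)
      then have "p \<noteq> i" "p \<noteq> j" "p < length v" "i < length v" using ij by auto
      then show "x \<noteq> k" "x \<noteq> Suc k" using d ij p by (metis nth_eq_iff_index_eq)+
    qed
    then have "map (transpose k (Suc k)) (take i v) = take i v"
      by (intro map_idI) (auto simp: transpose_def)
    then have "w = take i v @ Suc k # map (transpose k (Suc k)) (drop (Suc i) v)"
      unfolding w by (subst v) simp
    then show ?thesis by (subst v) (simp add: lexord_append_leftI)
  qed
qed

lemma weak_le_antisym:
  assumes "weak_le v w" "weak_le w v" "distinct v"
  shows "v = w"
proof -
  have le: "x = y \<or> (x, y) \<in> lexord {(x, y). x < y}" "distinct y" if "weak_le x y" "distinct x" for x y
  proof -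
    from that(1) have "distinct y \<and> (x = y \<or> (x, y) \<in> lexord {(x, y). x < y})"
      unfolding weak_le_def
    proof (induction rule: rtranclp_induct)
      case base show ?case using that by simp
    next
      case (step y z)
      then show ?case using weak_cover_distinct(2,3) [OF step(2)]
        lexord_trans [of x y "{(x, y). x < y}" z]
        by (auto simp: trans_def)
    qed
    then show "x = y \<or> (x, y) \<in> lexord {(x, y). x < y}" "distinct y" by auto
  qed
  show ?thesis
  proof (rule ccontr)
    assume "v \<noteq> w"
    then have "(v, w) \<in> lexord {(x, y). x < y}" "(w, v) \<in> lexord {(x, y). x < y}"
      using le assms by metis+
    then have "(v, v) \<in> lexord {(x, y). x < y}" by (rule lexord_trans) (auto simp: trans_def)
    then show False by (subst (asm) lexord_irreflexive) auto
  qed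
qed

lemma weak_cover_context:
  assumes "weak_cover v w" "(set A \<union> set B) \<inter> (+) a ` set v = {}"
  shows "weak_cover (A @ map ((+) a) v @ B) (A @ map ((+) a) w @ B)"
proof -
  from assms(1) obtain i j k where ij: "i < j" "j < length v" "v ! i = k" "v ! j = Suc k"
    and w: "w = map (transpose k (Suc k)) v"
    by (auto elim: weak_cover.cases)
  have "k \<in> set v" "Suc k \<in> set v" using ij nth_mem by (metis less_trans)+
  then have nin: "a + k \<notin> set A \<union> set B" "Suc (a + k) \<notin> set A \<union> set B"
    using assms(2) by (force)+
  let ?t = "transpose (a + k) (Suc (a + k))"
  have "map ?t A = A" "map ?t B = B"
    using nin by (auto intro!: map_idI simp: transpose_def)
  moreover have "map ?t (map ((+) a) v) = map ((+) a) w"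
    unfolding w by (auto simp: transpose_def)
  ultimately have eq: "map ?t (A @ map ((+) a) v @ B) = A @ map ((+) a) w @ B" by simp
  have "weak_cover (A @ map ((+) a) v @ B) (map ?t (A @ map ((+) a) v @ B))"
    by (rule weak_cover.intros [of "length A + i" "length A + j"])
      (use ij in \<open>auto simp: nth_append\<close>)
  then show ?thesis by (simp only: eq)
qed

lemma weak_le_context:
  assumes "weak_le v w" "(set A \<union> set B) \<inter> (+) a ` set v = {}"
  shows "weak_le (A @ map ((+) a) v @ B) (A @ map ((+) a) w @ B)"
proof -
  from assms(1) have "set w = set v \<and> weak_le (A @ map ((+) a) v @ B) (A @ map ((+) a) w @ B)"
    unfolding weak_le_def
  proof (induction rule: rtranclp_induct)
    case base show ?case by simp
  next
    case (step y z)
    then have "weak_cover (A @ map ((+) a) y @ B) (A @ map ((+) a) z @ B)"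
      using assms(2) by (intro weak_cover_context) auto
    then show ?case using step weak_cover_distinct(1) [OF step(2)]
      by (auto intro: rtranclp.rtrancl_into_rtrancl)
  qed
  then show ?thesis by blast
qed

text \<open>
  As long as some letter \<open>k\<close> is left of \<open>n\<close> and \<open>k + 1\<close> is right of \<open>n\<close>, exchanging them is a cover
  that does not change the relative order on either side, hence stays in the fiber of \<^term>\<open>tau\<close>. The
  letters on the right decrease, so the process stops.
\<close>

lemma weak_le_raise_left_letters:
  assumes "distinct (u @ n # v)" "set (u @ n # v) = {1..n}"
  shows "\<exists>u' v'. weak_le (u @ n # v) (u' @ n # v') \<and> tau u' = tau u \<and> tau v' = tau v \<and>
    distinct (u' @ n # v') \<and> set (u' @ n # v') = {1..n} \<and> (\<forall>x \<in> set u'. \<forall>y \<in> set v'. y < x)"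
  using assms
proof (induction "sum_list v" arbitrary: u v rule: less_induct)
  case less
  note d = less.prems(1) and s = less.prems(2)
  show ?case
  proof (cases "\<forall>x \<in> set u. \<forall>y \<in> set v. y < x")
    case True
    with d s show ?thesis by (intro exI [of _ u] exI [of _ v]) (auto simp: weak_le_def)
  next
    case False
    then obtain x y where xy: "x \<in> set u" "y \<in> set v" "\<not> y < x" by blast
    then have "x < y" using d by (metis disjoint_iff distinct_append linorder_neqE_nat list.set_intros(2))
    \<comment> \<open>Between \<open>x\<close> on the left and the larger \<open>y\<close> on the right there are consecutive letters that
      change sides from left to right.\<close>
    define k where "k = Max {z \<in> set u. z < y}"
    have "k \<in> {z \<in> set u. z < y}" unfolding k_def using xy \<open>x < y\<close> by (intro Max_in) auto
    then have k: "k \<in> set u" "k < y" by auto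
    have "Suc k \<notin> set u"
    proof
      assume Sk: "Suc k \<in> set u"
      then have "Suc k \<noteq> y" using xy d by auto
      then have "Suc k \<in> {z \<in> set u. z < y}" using Sk k by auto
      then have "Suc k \<le> k" unfolding k_def by (intro Max_ge) auto
      then show False by simp
    qed
    moreover have "y \<le> n" "y \<noteq> n" using xy d s by auto
    then have "y < n" by simp
    then have "Suc k < n" using k by simp
    moreover have "Suc k \<in> set (u @ n # v)" unfolding s using \<open>Suc k < n\<close> by simp
    ultimately have Sk: "Suc k \<in> set v" "Suc k \<notin> set u" "Suc k < n" by auto
    have kv: "k \<notin> set v" using k d by auto
    let ?t = "transpose k (Suc k)"
    have tn: "?t n = n" using Sk by (simp add: transpose_def)
    obtain i where i: "i < length u" "u ! i = k" using k by (auto simp: in_set_conv_nth)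
    obtain j where j: "j < length v" "v ! j = Suc k" using Sk by (auto simp: in_set_conv_nth)
    have "weak_cover (u @ n # v) (map ?t (u @ n # v))"
      by (rule weak_cover.intros [of i "Suc (length u) + j"]) (use i j in \<open>auto simp: nth_append\<close>)
    then have cov: "weak_cover (u @ n # v) (map ?t u @ n # map ?t v)" by (simp add: tn)
    have tu: "tau (map ?t u) = tau u"
      by (rule tau_map, rule strict_mono_onI) (use Sk in \<open>auto simp: transpose_def\<close>)
    have tv: "tau (map ?t v) = tau v"
      by (rule tau_map, rule strict_mono_onI) (use kv in \<open>auto simp: transpose_def\<close>)
    have "sum_list (map ?t v) < sum_list v"
    proof -
      have "sum_list (map ?t v) = sum ?t (set v)"
        using d by (simp add: sum_list_distinct_conv_sum_set)
      also have "\<dots> < sum (\<lambda>x. x) (set v)"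
        by (rule sum_strict_mono_ex1) (use kv Sk in \<open>auto simp: transpose_def intro: bexI [of _ "Suc k"]\<close>)
      also have "\<dots> = sum_list v"
        using d sum_list_distinct_conv_sum_set [of v "\<lambda>x. x"] by simp
      finally show ?thesis .
    qed
    from less.hyps [OF this, of "map ?t u"] weak_cover_distinct [OF cov] d s
    obtain u' v' where *: "weak_le (map ?t u @ n # map ?t v) (u' @ n # v')"
      "tau u' = tau u" "tau v' = tau v"
      "distinct (u' @ n # v')" "set (u' @ n # v') = {1..n}" "\<forall>x \<in> set u'. \<forall>y \<in> set v'. y < x"
      using tu tv by auto
    moreover have "weak_le (u @ n # v) (u' @ n # v')"
      using cov *(1) unfolding weak_le_def by (rule converse_rtranclp_into_rtranclp)
    ultimately show ?thesis by blast
  qed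
qed

text \<open>The 132-avoiding word: all letters before \<open>n\<close> are larger than all letters after it.\<close>

fun max_word :: "ptree \<Rightarrow> nat list" where
  "max_word Leaf = []"
| "max_word (Node l _ r) = map ((+) (size r)) (max_word l) @ size (join l r) # max_word r"

lemma set_max_word: "set (max_word t) = {1..size t}"
proof (induction t)
  case Leaf show ?case by simp
next
  case (Node l u r)
  have "(+) (size r) ` {1..size l} = {size r + 1..size r + size l}" by simp
  then show ?case using Node by auto
qed

lemma length_max_word [simp]: "length (max_word t) = size t"
  by (induction t) auto

lemma distinct_max_word: "distinct (max_word t)"
  by (simp add: card_distinct set_max_word)

lemma tau_max_word: "tau (max_word t) = t"
proof (induction t)
  case Leaf show ?case by (simp add: tau.simps)
next
  case (Node l u r)
  have "tau (max_word (Node l u r)) = join (tau (map ((+) (size r)) (max_word l))) (tau (max_word r))"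
    unfolding max_word.simps by (rule tau_append) (auto simp: set_max_word)
  also have "tau (map ((+) (size r)) (max_word l)) = tau (max_word l)"
    by (rule tau_map) (auto simp: strict_mono_on_def)
  finally show ?case using Node by simp
qed

lemma max_word_in_fiber: "max_word t \<in> tau_fiber t"
  by (simp add: tau_fiber_def permutations_of_set_def set_max_word distinct_max_word tau_max_word)

lemma interval_split:
  fixes n :: nat
  assumes un: "A \<union> B = {1..<n}" and less: "\<forall>x \<in> A. \<forall>y \<in> B. y < x"
  shows "B = {1..card B}" "A = {Suc (card B)..<n}"
proof -
  have fin: "finite B" using un by (metis finite_Un finite_atLeastLessThan)
  have down: "{1..y} \<subseteq> B" if "y \<in> B" for y
  proof
    fix z assume z: "z \<in> {1..y}"
    have "y \<in> {1..<n}" using that un by blast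
    then have "z \<in> A \<union> B" using z un by simp
    then show "z \<in> B" using less that z by fastforce
  qed
  have "B \<subseteq> {1..card B}"
  proof
    fix y assume y: "y \<in> B"
    then have "y \<in> {1..<n}" using un by blast
    moreover have "y \<le> card B" using card_mono [OF fin down [OF y]] by simp
    ultimately show "y \<in> {1..card B}" by simp
  qed
  then show B: "B = {1..card B}" by (intro card_subset_eq) auto
  have "A \<inter> B = {}" using less by blast
  then have "A = {1..<n} - {1..card B}" using un B by blast
  then show "A = {Suc (card B)..<n}" by auto
qed

text \<open>
  After the letters left of \<open>n\<close> have been raised above those on the right, the two sides can be
  treated separately by induction.
\<close>

lemma weak_le_max_word:
  assumes "v \<in> tau_fiber t"
  shows "weak_le v (max_word t)"
  using assms
proof (induction t arbitrary: v)
  case Leaf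
  then show ?case by (simp add: tau_fiber_def weak_le_def)
next
  case (Node l x r)
  let ?n = "size (join l r)"
  have d: "distinct v" and s: "set v = {1..?n}" and t: "tau v = join l r"
    using Node.prems by (auto simp: tau_fiber_def permutations_of_set_def)
  have "?n \<in> set v" using s by simp
  then obtain a b where v: "v = a @ ?n # b" by (meson split_list)
  obtain a' b' where ab: "weak_le v (a' @ ?n # b')" "tau a' = tau a" "tau b' = tau b"
      "distinct (a' @ ?n # b')" "set (a' @ ?n # b') = {1..?n}" "\<forall>x \<in> set a'. \<forall>y \<in> set b'. y < x"
    using weak_le_raise_left_letters [of a ?n b] d s v by auto
  have lt: "\<forall>z \<in> set p \<union> set q. z < ?n" if "distinct (p @ ?n # q)" "set (p @ ?n # q) = {1..?n}" for p q
  proof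
    fix z assume z: "z \<in> set p \<union> set q"
    then have "z \<in> {1..?n}" using that(2) by auto
    moreover have "z \<noteq> ?n" using z that(1) by auto
    ultimately show "z < ?n" by simp
  qed
  have "tau v = join (tau a) (tau b)"
    unfolding v by (rule tau_append) (use lt [of a b] d s v in simp)
  then have tl: "tau a' = l" "tau b' = r" using t ab by auto
  have lb: "length b' = size r" using tl size_tau_node_le [of b'] by auto
  have un: "set a' \<union> set b' = {1..<?n}"
  proof -
    have "set a' \<union> set b' = {1..?n} - {?n}" using ab(4,5) by auto
    also have "{1..n} - {n} = {1..<n}" for n :: nat by auto
    finally show ?thesis .
  qed
  have "card (set b') = size r" using ab(4) lb distinct_card [of b'] by simp
  then have sb: "set b' = {1..size r}" and sa: "set a' = {Suc (size r)..<?n}"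
    using interval_split [OF un ab(6)] by simp_all
  define c where "c = map (\<lambda>z. z - size r) a'"
  have a': "a' = map ((+) (size r)) c"
    using sa by (auto simp: c_def intro!: map_idI [symmetric])
  have "c \<in> tau_fiber l"
  proof -
    have "set c = {1..size l}"
    proof -
      have "(+) (size r) ` set c = (+) (size r) ` {1..size l}" using sa a' by auto
      then show ?thesis by (subst (asm) inj_image_eq_iff) auto
    qed
    moreover have "distinct c" using ab(4) unfolding a' by (auto simp: distinct_map)
    moreover have "tau c = l"
    proof -
      have "tau a' = tau c" unfolding a' by (rule tau_map) (auto simp: strict_mono_on_def)
      then show ?thesis using tl by simp
    qed
    ultimately show ?thesis by (simp add: tau_fiber_def permutations_of_set_def)
  qed
  then have lec: "weak_le c (max_word l)" by (rule Node.IH(1))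
  have "b' \<in> tau_fiber r"
    using sb ab(4) tl by (simp add: tau_fiber_def permutations_of_set_def)
  then have leb: "weak_le b' (max_word r)" by (rule Node.IH(2))
  have "weak_le ([] @ map ((+) (size r)) c @ ?n # b') ([] @ map ((+) (size r)) (max_word l) @ ?n # b')"
    using lec by (rule weak_le_context) (use ab(4) a' in auto)
  moreover have "weak_le ((map ((+) (size r)) (max_word l) @ [?n]) @ map ((+) 0) b' @ [])
      ((map ((+) (size r)) (max_word l) @ [?n]) @ map ((+) 0) (max_word r) @ [])"
    using leb by (rule weak_le_context) (use sb in \<open>auto simp: set_max_word\<close>)
  ultimately have "weak_le (a' @ ?n # b') (max_word (Node l x r))"
    unfolding weak_le_def a' by (simp add: map_idI [where f = "(+) 0"])
  with ab(1) show ?case unfolding weak_le_def by simp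
qed

theorem max_perm_eq: "max_perm t = max_word t"
  unfolding max_perm_def
proof (rule the_equality)
  show "max_word t \<in> tau_fiber t \<and> (\<forall>v \<in> tau_fiber t. weak_le v (max_word t))"
    by (simp add: max_word_in_fiber weak_le_max_word)
next
  fix w assume w: "w \<in> tau_fiber t \<and> (\<forall>v \<in> tau_fiber t. weak_le v w)"
  then have "distinct w" by (auto simp: tau_fiber_def permutations_of_set_def)
  with w show "w = max_word t"
    using weak_le_antisym max_word_in_fiber weak_le_max_word by blast
qed

text \<open>
  In this word every letter right of \<open>n\<close> is smaller than the first letter, so the nodes that carry
  a letter at least as large as the first one are the root and, recursively, such nodes on the left.
\<close>

lemma max_word_ge_first:
  "i \<in> {1..size t} \<and> max_word t ! 0 \<le> max_word t ! (i - 1) \<longleftrightarrow> i \<in> left_spine t"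
proof (induction t arbitrary: i)
  case Leaf show ?case by simp
next
  case (Node l u r)
  define w where "w = max_word (Node l u r)"
  define n where "n = size (Node l u r)"
  have n: "n = Suc (size l + size r)" by (simp add: n_def)
  have w: "w = map ((+) (size r)) (max_word l) @ n # max_word r" by (simp add: w_def n_def)
  have left: "w ! j = size r + max_word l ! j" if "j < size l" for j
    using that by (simp add: w nth_append)
  have root: "w ! size l = n" by (simp add: w nth_append)
  have right: "w ! (i - 1) \<le> size r" if i: "Suc (size l) < i" "i \<le> n" for i
  proof -
    define k where "k = i - 2 - size l"
    have k: "i - 1 = size l + Suc k" "k < size r" using i n by (auto simp: k_def)
    have "w ! (i - 1) = max_word r ! k" unfolding k(1) by (simp add: w nth_append)
    moreover have "max_word r ! k \<in> set (max_word r)" using k by simp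
    ultimately show ?thesis by (simp add: set_max_word)
  qed
  have first: "size r < w ! 0 \<and> w ! 0 \<le> n"
  proof (cases "l = Leaf")
    case True then show ?thesis using root n by simp
  next
    case False
    then have pos: "0 < size l" by (cases l) auto
    then have "max_word l ! 0 \<in> set (max_word l)" by simp
    then show ?thesis using left [OF pos] n by (auto simp: set_max_word)
  qed
  consider "i = 0 \<or> n < i" | "1 \<le> i" "i \<le> size l" | "i = Suc (size l)" | "Suc (size l) < i" "i \<le> n"
    by linarith
  then have "i \<in> {1..n} \<and> w ! 0 \<le> w ! (i - 1) \<longleftrightarrow> i \<in> left_spine (Node l u r)"
  proof cases
    case 1 then show ?thesis using left_spine_subset [of l] n by auto
  next
    case 2
    then have "w ! (i - 1) = size r + max_word l ! (i - 1)" "w ! 0 = size r + max_word l ! 0"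
      by (auto intro: left)
    then show ?thesis using 2 Node.IH(1) [of i] n by auto
  next
    case 3 then show ?thesis using root first n by simp
  next
    case 4
    then have "i \<notin> left_spine (Node l u r)" using left_spine_subset [of l] by auto
    moreover have "\<not> w ! 0 \<le> w ! (i - 1)" using right [OF 4] first by simp
    ultimately show ?thesis by simp
  qed
  then show ?case unfolding w_def n_def .
qed

lemma phi_ideal_beta_max_perm:
  "phi (beta (max_perm t)) = t" "ideal (beta (max_perm t)) = left_spine t"
  using phi_ideal_beta [OF distinct_max_word [of t]] max_word_ge_first [of _ t]
  by (auto simp: max_perm_eq tau_max_word)

text \<open>
  The inclusion of the order ideals is automatic: by antitonicity the left spine of \<open>t\<close> is contained in that
  of \<^term>\<open>phi b\<close>, and hence in the ideal of \<open>b\<close>.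
\<close>

lemma le_beta_max_perm_iff: "b \<le> beta (max_perm t) \<longleftrightarrow> tamari_le (phi b) t"
  using left_spine_antimono [of "phi b" t] left_spine_subset_ideal [of b]
  by (auto simp: less_eq_bltree_def phi_ideal_beta_max_perm)


section \<open>Coinvariants\<close>

text \<open>
  This completes \<^term>\<open>backslash\<close> to the right adjoint of splitting. For \<open>c = |\<close> an order ideal has
  to be chosen on \<open>s\<close>, and adjointness forces the smallest one.
\<close>

definition extend :: "bltree \<Rightarrow> ptree \<Rightarrow> bltree" where
  "extend c s = (if phi c = Leaf then beta (max_perm s) else backslash c s)"

lemma ideal_subset: "ideal b \<subseteq> {1..size (phi b)}"
  using is_bileveled_phi_ideal [of b] by (simp add: is_bileveled_def)

lemma phi_extend: "phi (extend c s) = graft_right (phi c) s"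
  by (auto simp: extend_def phi_ideal_beta_max_perm phi_ideal_backslash)

lemma extend_Leaf: "extend c Leaf = c"
proof -
  have graft: "graft_right t Leaf = t" for t by (induction t) auto
  show ?thesis
  proof (rule bltree_eqI)
    show "phi (extend c Leaf) = phi c" by (simp add: phi_extend graft)
    show "ideal (extend c Leaf) = ideal c"
      using ideal_subset [of c]
      by (auto simp: extend_def phi_ideal_beta_max_perm phi_ideal_backslash)
  qed
qed

theorem le_extend_iff:
  "b \<le> extend c s \<longleftrightarrow> size (phi c) \<le> size (phi b) \<and> left_part b (size (phi c)) \<le> c \<and>
     tamari_le (snd (split_tree (phi b) (size (phi c)))) s"
proof (cases "size (phi c) \<le> size (phi b)")
  case False
  then show ?thesis
    using tamari_le_size [of "phi b" "phi (extend c s)"] by (auto simp: less_eq_bltree_def phi_extend)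
next
  case size: True
  note lp = phi_ideal_left_part [OF size]
  show ?thesis
  proof (cases "phi c = Leaf")
    case True
    then have "extend c s = beta (max_perm s)" by (simp add: extend_def)
    moreover have "left_part b (size (phi c)) \<le> c"
      using True lp ideal_subset [of c] by (simp add: split_tree_0 less_eq_bltree_def)
    ultimately show ?thesis using True by (simp add: le_beta_max_perm_iff split_tree_0)
  next
    case False
    then show ?thesis using lp size ideal_subset [of c]
      by (auto simp: extend_def less_eq_bltree_def phi_ideal_backslash tamari_le_graft_right_iff)
  qed
qed

abbreviation pair_le :: "bltree \<times> ptree \<Rightarrow> bltree \<times> ptree \<Rightarrow> bool" where
  "pair_le \<equiv> rel_prod (\<le>) tamari_le"

text \<open>At most one splitting contributes, the one along the leaf that matches the size of \<open>c\<close>.\<close>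

lemma lower_sum_rho_F: "lower_sum pair_le (c, s) (rho_F b) = of_bool (b \<le> extend c s)"
proof -
  let ?n = "size (phi c)"
  let ?P = "\<lambda>i. left_part b i \<le> c \<and> tamari_le (snd (split_tree (phi b) i)) s"
  have size: "i = ?n" if "i \<le> size (phi b)" "left_part b i \<le> c" for i
    using that phi_ideal_left_part [OF that(1)] size_split_tree [OF that(1)]
      tamari_le_size [of "phi (left_part b i)" "phi c"]
    by (simp add: less_eq_bltree_def)
  have "lower_sum pair_le (c, s) (rho_F b) = (\<Sum>i\<le>size (phi b). of_bool (?P i))"
    by (simp add: rho_F_def lower_sum_sum tensor_F)
  also have "\<dots> = (\<Sum>i\<le>size (phi b). if i = ?n then of_bool (?P ?n) else 0)"
    using size by (intro sum.cong) auto
  also have "\<dots> = of_bool (b \<le> extend c s)" by (simp add: le_extend_iff)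
  finally show ?thesis .
qed

theorem lower_sum_rho: "lower_sum pair_le (c, s) (rho m) = lower_sum (\<le>) (extend c s) m"
proof -
  have "lower_sum pair_le (c, s) (rho m)
      = (\<Sum>b \<in> keys m. lookup m b * of_bool (b \<le> extend c s))"
    by (simp add: rho_def lower_sum_sum lower_sum_scl lower_sum_rho_F)
  also have "\<dots> = lower_sum (\<le>) (extend c s) m"
    unfolding lower_sum_def by (intro sum.cong) auto
  finally show ?thesis .
qed

lemma lower_sum_tensor_one:
  "lower_sum pair_le (c, s) (m \<otimes> F Leaf) = (if s = Leaf then lower_sum (\<le>) c m else 0)"
proof -
  have Leaf: "tamari_le Leaf s \<longleftrightarrow> s = Leaf"
    using tamari_le_size [of Leaf s] by auto
  have "m \<otimes> F Leaf = (\<Sum>b \<in> keys m. scl (lookup m b) (F (b, Leaf :: ptree)))"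
    unfolding tensor_def
    by (rule sum.cong) (auto intro!: poly_mapping_eqI simp: lookup_single when_def)
  then have "lower_sum pair_le (c, s) (m \<otimes> F Leaf)
      = (\<Sum>b \<in> keys m. lookup m b * lower_sum pair_le (c, s) (F (b, Leaf)))"
    by (simp only: lower_sum_sum lower_sum_scl)
  also have "\<dots> = (if s = Leaf then lower_sum (\<le>) c m else 0)"
    unfolding lower_sum_F lower_sum_def by (auto simp: Leaf intro!: sum.cong)
  finally show ?thesis .
qed

lemma coinvariants_iff:
  "m \<in> coinvariants \<longleftrightarrow> (\<forall>c s. s \<noteq> Leaf \<longrightarrow> lower_sum (\<le>) (extend c s) m = 0)"
proof
  assume "m \<in> coinvariants"
  then have "rho m = m \<otimes> F Leaf" by (simp add: coinvariants_def)
  then show "\<forall>c s. s \<noteq> Leaf \<longrightarrow> lower_sum (\<le>) (extend c s) m = 0"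
    by (metis lower_sum_rho lower_sum_tensor_one)
next
  assume R: "\<forall>c s. s \<noteq> Leaf \<longrightarrow> lower_sum (\<le>) (extend c s) m = 0"
  have "rho m = m \<otimes> F Leaf"
  proof (rule lower_sum_inject [of pair_le])
    show "reflp pair_le" by (auto simp: reflp_def)
    show "antisymp pair_le" by (auto simp: antisymp_def intro: tamari_le_antisym)
    show "transp pair_le" by (auto simp: transp_def intro: tamari_le_trans)
    fix p :: "bltree \<times> ptree"
    show "lower_sum pair_le p (rho m) = lower_sum pair_le p (m \<otimes> F Leaf)"
      using R by (cases p) (simp add: lower_sum_rho lower_sum_tensor_one extend_Leaf)
  qed
  then show "m \<in> coinvariants" by (simp add: coinvariants_def)
qed

text \<open>
  Grafting a nonempty tree onto \<open>c \<noteq> |\<close> gives the decomposable trees, and onto \<open>c = |\<close> the trees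
  \<^term>\<open>beta (max_perm t)\<close>.
\<close>

lemma not_in_B'_iff: "b \<notin> B' \<longleftrightarrow> (\<exists>c s. s \<noteq> Leaf \<and> b = extend c s)"
proof
  assume "b \<notin> B'"
  then have ne: "phi b \<noteq> Leaf" and "b \<notin> indecomposables \<or> (\<exists>t. t \<noteq> Leaf \<and> b = beta (max_perm t))"
    by (auto simp: B'_def)
  then consider t where "t \<noteq> Leaf" "b = beta (max_perm t)"
    | c s where "phi c \<noteq> Leaf" "b = backslash c s" "\<not> (c = b \<and> s = Leaf)"
    by (auto simp: indecomposables_def)
  then show "\<exists>c s. s \<noteq> Leaf \<and> b = extend c s"
  proof cases
    case 1
    have "phi (beta (max_perm Leaf)) = Leaf" by (simp add: phi_ideal_beta_max_perm)
    with 1 show ?thesis by (metis extend_def)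
  next
    case 2
    then have b: "b = extend c s" by (simp add: extend_def)
    with 2 have "s \<noteq> Leaf" by (auto simp: extend_Leaf)
    with b show ?thesis by blast
  qed
next
  assume "\<exists>c s. s \<noteq> Leaf \<and> b = extend c s"
  then obtain c s where s: "s \<noteq> Leaf" and b: "b = extend c s" by blast
  have "size (phi b) \<noteq> 0" using s by (simp add: b phi_extend)
  then have ne: "phi b \<noteq> Leaf" by auto
  show "b \<notin> B'"
  proof (cases "phi c = Leaf")
    case True
    then show ?thesis using ne s b by (auto simp: B'_def extend_def)
  next
    case False
    then have "b = backslash c s" using b by (simp add: extend_def)
    then have "b \<notin> indecomposables" using False s by (auto simp: indecomposables_def)
    then show ?thesis using ne by (simp add: B'_def)
  qed
qed

theorem corollary4p5:
  shows "inj_on M B' \<and> rvec.independent (M ` B') \<and> rvec.span (M ` B') = coinvariants"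
proof (intro conjI)
  show "inj_on M B'" using inj_M by (rule inj_on_subset) simp
  show "rvec.independent (M ` B')" by (rule independent_M)
  show "rvec.span (M ` B') = coinvariants"
    unfolding set_eq_iff span_M_iff coinvariants_iff not_in_B'_iff by blast
qed

end
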